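(* Let $X$ be an SCLCS, $n\ge2$ and $x\in X$. Suppose that $0<\alpha_j\le\pi$ for all $1\le j\le n$, that the function $f:\Sigma_{\alpha_1}\times\dots\times\Sigma_{\alpha_n}\to X$ is holomorphic, and that for all $\beta_j\in(0,\alpha_j)$ ($1\le j\le n$) the set $\{f(z_1,\dots,z_n):z_j\in\Sigma_{\beta_j}\text{ for all }1\le j\le n\}$ is bounded in $X$. (i) Let $\beta_j\in(0,\alpha_j)$ for $1\le j\le n$. Then $\lim_{t_1\to+\infty;\dots;t_n\to+\infty}f(t_1,\dots,t_n)=x$ if and only if $$\lim_{|z_1|\to+\infty;\dots;|z_n|\to+\infty;\ (z_1,\dots,z_n)\in\Sigma_{\beta_1}\times\dots\times\Sigma_{\beta_n}}f(z_1,\dots,z_n)=x .$$ (ii) Let $\beta_j\in(0,\alpha_j)$ for $1\le j\le n$. Then $\lim_{(t_1,\dots,t_n)\to(0,\dots,0)}f(t_1,\dots,t_n)=x$ if and only if $$\lim_{(z_1,\dots,z_n)\to(0,\dots,0);\ (z_1,\dots,z_n)\in\Sigma_{\beta_1}\times\dots\times\Sigma_{\beta_n}}f(z_1,\dots,z_n)=x .$$ Here $t_1,\dots,t_n$ range over positive real numbers.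
   Context: An SCLCS is a Hausdorff sequentially complete locally convex space over $\mathbb C$. For $0<\alpha\le\pi$, $\Sigma_\alpha:=\{z\in\mathbb C\setminus\{0\}:|\arg z|<\alpha\}$. Holomorphic (analytic) means that near each point (on a polydisc) the function is the sum of a power series with coefficients in $X$ that converges absolutely with respect to every continuous seminorm. Limits are joint limits in the topology of $X$: e.g. $\lim_{|z_1|\to+\infty;\dots;|z_n|\to+\infty}f=x$ means that for every $\epsilon>0$ and every continuous seminorm $p$ there is $M>0$ with $p(f(z_1,\dots,z_n)-x)<\epsilon$ whenever all $|z_j|>M$. *)

theory Defs
  imports "HOL-Analysis.Analysis"
begin

text \<open>The libraries have no class of complex topological vector spaces. A complex vector space is
  therefore given, as in \<^theory>\<open>HOL.Vector_Spaces\<close>, by a scalar multiplication \<open>smul\<close> on an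
  additive group, and its topology is the one of the type class.\<close>

definition seminorm :: "(complex \<Rightarrow> 'x \<Rightarrow> 'x) \<Rightarrow> ('x::ab_group_add \<Rightarrow> real) \<Rightarrow> bool" where
  "seminorm smul p \<longleftrightarrow>
     (\<forall>v w. p (v + w) \<le> p v + p w) \<and> (\<forall>c v. p (smul c v) = cmod c * p v)"

definition continuous_seminorm ::
    "(complex \<Rightarrow> 'x \<Rightarrow> 'x) \<Rightarrow> ('x::{ab_group_add,topological_space} \<Rightarrow> real) \<Rightarrow> bool" where
  "continuous_seminorm smul p \<longleftrightarrow> seminorm smul p \<and> continuous_on UNIV p"

text \<open>Hausdorff, sequentially complete, locally convex spaces over the complex numbers. The Hausdorff
  property is the class constraint \<^class>\<open>t2_space\<close>. Locally convex means that the topology is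
  the one generated by some family \<open>P\<close> of seminorms.\<close>

locale sclcs = vector_space smul
  for smul :: "complex \<Rightarrow> 'x \<Rightarrow> 'x::{ab_group_add,t2_space}" +
  assumes locally_convex:
    "\<exists>P. (\<forall>p\<in>P. seminorm smul p) \<and>
       (\<forall>U. open U \<longleftrightarrow>
         (\<forall>v\<in>U. \<exists>F e. finite F \<and> F \<subseteq> P \<and> 0 < e \<and> {w. \<forall>p\<in>F. p (w - v) < e} \<subseteq> U))"
  and sequentially_complete:
    "\<And>s :: nat \<Rightarrow> 'x.
       (\<forall>p. continuous_seminorm smul p \<longrightarrow>
          (\<forall>e>0. \<exists>N. \<forall>m\<ge>N. \<forall>k\<ge>N. p (s m - s k) < e)) \<Longrightarrow> convergent s"

definition lc_bounded ::
    "(complex \<Rightarrow> 'x \<Rightarrow> 'x) \<Rightarrow> 'x::{ab_group_add,topological_space} set \<Rightarrow> bool" where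
  "lc_bounded smul B \<longleftrightarrow> (\<forall>p. continuous_seminorm smul p \<longrightarrow> bdd_above (p ` B))"

definition polydisc :: "complex ^ 'n \<Rightarrow> real ^ 'n \<Rightarrow> (complex ^ 'n) set" where
  "polydisc a r = {z. \<forall>j. cmod (z $ j - a $ j) < r $ j}"

definition lc_holomorphic_on ::
    "(complex \<Rightarrow> 'x \<Rightarrow> 'x) \<Rightarrow> (complex ^ 'n::finite \<Rightarrow> 'x::{ab_group_add,topological_space}) \<Rightarrow>
       (complex ^ 'n) set \<Rightarrow> bool" where
  "lc_holomorphic_on smul f D \<longleftrightarrow>
     (\<forall>a\<in>D. \<exists>(r :: real ^ 'n) (c :: nat ^ 'n \<Rightarrow> 'x). (\<forall>j. 0 < r $ j) \<and> polydisc a r \<subseteq> D \<and>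
        (\<forall>z\<in>polydisc a r.
           (\<forall>p. continuous_seminorm smul p \<longrightarrow>
              (\<lambda>k. p (smul (\<Prod>j\<in>UNIV. (z $ j - a $ j) ^ (k $ j)) (c k))) summable_on UNIV) \<and>
           ((\<lambda>k. smul (\<Prod>j\<in>UNIV. (z $ j - a $ j) ^ (k $ j)) (c k)) has_sum f z) UNIV))"

definition sector :: "real \<Rightarrow> complex set" where
  "sector \<alpha> = {z. z \<noteq> 0 \<and> \<bar>Arg z\<bar> < \<alpha>}"

definition sectors :: "real ^ 'n \<Rightarrow> (complex ^ 'n) set" where
  "sectors \<alpha> = {z. \<forall>j. z $ j \<in> sector (\<alpha> $ j)}"

definition cvec :: "real ^ 'n \<Rightarrow> complex ^ 'n" where
  "cvec t = (\<chi> j. complex_of_real (t $ j))"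

text \<open>The filters of the two joint limits at infinity, in which all coordinates tend to infinity
  independently of each other (unlike in \<^const>\<open>at_infinity\<close> on the product space).\<close>

definition each_at_infinity_within :: "(complex ^ 'n) set \<Rightarrow> (complex ^ 'n) filter" where
  "each_at_infinity_within S = (INF M\<in>{0<..}. principal {z\<in>S. \<forall>j. M < cmod (z $ j)})"

definition each_at_top :: "(real ^ 'n) filter" where
  "each_at_top = (INF M\<in>{0<..}. principal {t. \<forall>j. M < t $ j})"

lemma eventually_each_at_infinity_within:
  "eventually Q (each_at_infinity_within S) \<longleftrightarrow>
     (\<exists>M>0. \<forall>z\<in>S. (\<forall>j. M < cmod (z $ j)) \<longrightarrow> Q z)"
proof -
  have "eventually Q (each_at_infinity_within S) \<longleftrightarrow>
      (\<exists>M\<in>{0<..}. eventually Q (principal {z\<in>S. \<forall>j. M < cmod (z $ j)}))"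
    unfolding each_at_infinity_within_def
  proof (rule eventually_INF_base)
    fix M N :: real assume "M \<in> {0<..}" "N \<in> {0<..}"
    then show "\<exists>x\<in>{0<..}. principal {z\<in>S. \<forall>j. x < cmod (z $ j)}
        \<le> inf (principal {z\<in>S. \<forall>j. M < cmod (z $ j)}) (principal {z\<in>S. \<forall>j. N < cmod (z $ j)})"
      by (intro bexI[of _ "max M N"]) auto
  qed simp
  then show ?thesis by (simp add: eventually_principal Bex_def Ball_def imp_conjL)
qed

lemma eventually_each_at_top:
  "eventually Q each_at_top \<longleftrightarrow> (\<exists>M>0. \<forall>t. (\<forall>j. M < t $ j) \<longrightarrow> Q t)"
proof -
  have "eventually Q each_at_top \<longleftrightarrow>
      (\<exists>M\<in>{0<..}. eventually Q (principal {t. \<forall>j. M < t $ j}))"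
    unfolding each_at_top_def
  proof (rule eventually_INF_base)
    fix M N :: real assume "M \<in> {0<..}" "N \<in> {0<..}"
    then show "\<exists>x\<in>{0<..}. principal {t. \<forall>j. x < t $ j}
        \<le> inf (principal {t. \<forall>j. M < t $ j}) (principal {t. \<forall>j. N < t $ j})"
      by (intro bexI[of _ "max M N"]) auto
  qed simp
  then show ?thesis by (simp add: eventually_principal Bex_def Ball_def imp_conjL)
qed

text \<open>Convergence in the topology of the space is convergence with respect to every continuous
  seminorm.\<close>

lemma (in sclcs) tendsto_iff_seminorm:
  "(g \<longlongrightarrow> x) F \<longleftrightarrow>
     (\<forall>p. continuous_seminorm smul p \<longrightarrow> (\<forall>e>0. eventually (\<lambda>a. p (g a - x) < e) F))"
proof -
  from locally_convex obtain P where P_op: "(\<forall>p\<in>P. seminorm smul p) \<and>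
       (\<forall>U. open U \<longleftrightarrow>
         (\<forall>v\<in>U. \<exists>F e. finite F \<and> F \<subseteq> P \<and> 0 < e \<and> {w. \<forall>p\<in>F. p (w - v) < e} \<subseteq> U))"
    by (rule exE)
  note P = P_op[THEN conjunct1, rule_format] and op = P_op[THEN conjunct2, THEN spec]
  have zero: "p 0 = 0" if "seminorm smul p" for p
  proof -
    have "p (smul 0 0) = cmod 0 * p 0" using that unfolding seminorm_def by blast
    then show ?thesis by simp
  qed
  have tri: "p (v + w) \<le> p v + p w" if "seminorm smul p" for p v w
    using that unfolding seminorm_def by blast
  have minus: "p (- v) = p v" if "seminorm smul p" for p v
  proof -
    have "p (smul (-1) v) = cmod (-1) * p v" using that unfolding seminorm_def by blast
    then show ?thesis by simp
  qed
  have trans: "open {w. w - x \<in> U}" if "open U" for U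
    unfolding op[of "{w. w - x \<in> U}"]
  proof
    fix v assume "v \<in> {w. w - x \<in> U}"
    then have "v - x \<in> U" by simp
    from bspec[OF op[THEN iffD1, OF \<open>open U\<close>] this]
    obtain F e where F: "finite F" "F \<subseteq> P" "0 < e" "{w. \<forall>p\<in>F. p (w - (v - x)) < e} \<subseteq> U"
      by (elim exE conjE) (rule that)
    have "{w. \<forall>p\<in>F. p (w - v) < e} \<subseteq> {w. w - x \<in> U}"
    proof
      fix w assume "w \<in> {w. \<forall>p\<in>F. p (w - v) < e}"
      then have "w - x \<in> {w. \<forall>p\<in>F. p (w - (v - x)) < e}" by simp
      then have "w - x \<in> U" using F(4) by (rule rev_subsetD)
      then show "w \<in> {w. w - x \<in> U}" by simp
    qed
    then show "\<exists>F e. finite F \<and> F \<subseteq> P \<and> 0 < e \<and> {w. \<forall>p\<in>F. p (w - v) < e} \<subseteq> {w. w - x \<in> U}"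
      using F(1-3) by (intro exI conjI)
  qed
  have cont: "continuous_seminorm smul p" if "p \<in> P" for p
    unfolding continuous_seminorm_def continuous_on_open_vimage[OF open_UNIV]
  proof (intro conjI allI impI)
    show "seminorm smul p" using P that .
    fix B :: "real set" assume B: "open B"
    have "open (p -` B)" unfolding op
    proof
      fix v assume "v \<in> p -` B"
      then obtain e where e: "e > 0" "\<And>y. dist y (p v) < e \<Longrightarrow> y \<in> B"
        using B unfolding open_dist by blast
      have "{w. p (w - v) < e} \<subseteq> p -` B"
      proof
        fix w assume w: "w \<in> {w. p (w - v) < e}"
        have "p w \<le> p v + p (w - v)" using tri[OF P[OF that], of v "w - v"] by simp
        moreover have "p v \<le> p w + p (w - v)"
          using tri[OF P[OF that], of w "- (w - v)"] minus[OF P[OF that], of "w - v"] by simp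
        ultimately show "w \<in> p -` B" using w e(2)[of "p w"] by (auto simp: dist_real_def)
      qed
      then show "\<exists>F e. finite F \<and> F \<subseteq> P \<and> 0 < e \<and> {w. \<forall>p\<in>F. p (w - v) < e} \<subseteq> p -` B"
        using that e(1) by (intro exI[of _ "{p}"] exI[of _ e] conjI) simp_all
    qed
    then show "open (p -` B \<inter> UNIV)" by simp
  qed
  show ?thesis
  proof (intro iffI allI impI)
    fix p and e :: real
    assume lim: "(g \<longlongrightarrow> x) F" and p: "continuous_seminorm smul p" and e: "0 < e"
    have "continuous_on UNIV p" using p unfolding continuous_seminorm_def by blast
    with open_lessThan have "open (p -` {..<e})" by (rule open_vimage)
    then have "open {w. w - x \<in> p -` {..<e}}" by (rule trans)
    moreover have "x \<in> {w. w - x \<in> p -` {..<e}}"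
      using zero[of p] p e unfolding continuous_seminorm_def by simp
    ultimately have "eventually (\<lambda>a. g a \<in> {w. w - x \<in> p -` {..<e}}) F"
      by (rule topological_tendstoD[OF lim])
    then show "eventually (\<lambda>a. p (g a - x) < e) F" by simp
  next
    assume R: "\<forall>p. continuous_seminorm smul p \<longrightarrow> (\<forall>e>0. eventually (\<lambda>a. p (g a - x) < e) F)"
    show "(g \<longlongrightarrow> x) F"
    proof (rule topological_tendstoI)
      fix U assume "open U" "x \<in> U"
      from bspec[OF op[THEN iffD1, OF \<open>open U\<close>] \<open>x \<in> U\<close>]
      obtain G e where G: "finite G" "G \<subseteq> P" "0 < e" "{w. \<forall>p\<in>G. p (w - x) < e} \<subseteq> U"
        by (elim exE conjE) (rule that)
      have "eventually (\<lambda>a. \<forall>p\<in>G. p (g a - x) < e) F"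
        using G R cont by (intro eventually_ball_finite) auto
      then show "eventually (\<lambda>a. g a \<in> U) F"
        by (rule eventually_mono) (use G(4) in auto)
    qed
  qed
qed

end

theory Submission
  imports Defs "HOL-Complex_Analysis.Great_Picard"
begin

text \<open>A bounded scalar holomorphic function on a sector that is small on \<open>[1/2, 2]\<close> is small on the
  arc of the unit circle in a narrower sector, with a modulus that depends only on the bound and the
  angles: otherwise Montel's theorem would give a nonzero limit that vanishes on \<open>[1/2, 2]\<close>. Applied
  to \<open>u \<mapsto> \<phi> (f (\<dots>, u \<bar>z\<^sub>j\<bar>, \<dots>) - x)\<close>, where the functional \<open>\<phi>\<close> is dominated by the seminorm \<open>p\<close>
  and norms \<open>f z - x\<close>, this lets one turn the coordinates of \<open>z\<close> one by one from the half-line into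
  the sector, uniformly in the moduli. Hence \<open>p (f z - x)\<close> is small as soon as \<open>p (f t - x)\<close> is small for
  all positive \<open>t\<close> with \<open>2\<^sup>-\<^sup>n \<bar>z\<^sub>j\<bar> \<le> t\<^sub>j \<le> 2\<^sup>n \<bar>z\<^sub>j\<bar>\<close>, which yields both limits.\<close>

section \<open>Sublinear functionals and the Hahn-Banach theorem\<close>

text \<open>The scalar multiplication \<open>sc\<close> is a parameter because the theory is applied
  to a complex space with its scalars restricted to the reals.\<close>

definition sublinear :: "(real \<Rightarrow> 'x \<Rightarrow> 'x) \<Rightarrow> ('x::ab_group_add \<Rightarrow> real) \<Rightarrow> bool" where
  "sublinear sc q \<longleftrightarrow>
     (\<forall>v w. q (v + w) \<le> q v + q w) \<and> (\<forall>c\<ge>0. \<forall>v. q (sc c v) = c * q v)"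

lemma sublinear_add: "sublinear sc q \<Longrightarrow> q (v + w) \<le> q v + q w"
  and sublinear_scale: "sublinear sc q \<Longrightarrow> 0 \<le> c \<Longrightarrow> q (sc c v) = c * q v"
  by (auto simp: sublinear_def)

text \<open>The inequality at \<open>inverse c\<close> gives the reverse one at \<open>c\<close>,
  and the factors \<open>2\<close> and \<open>1/2\<close> at the zero vector force
  \<open>q 0 = 0\<close>. Infima are thereby easy to recognise as sublinear.\<close>

lemma sublinearI:
  assumes "vector_space sc"
    and add: "\<And>v w. q (v + w) \<le> q v + q w"
    and le: "\<And>c v. 0 < c \<Longrightarrow> q (sc c v) \<le> c * q v"
  shows "sublinear sc q"
proof -
  interpret vector_space sc by fact
  have zero: "q 0 = 0"
    using le[of 2 0] le[of "1/2" 0] by simp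
  have "q (sc c v) = c * q v" if "0 < c" for c v
  proof (rule antisym[OF le[OF that]])
    have "q (sc (inverse c) (sc c v)) \<le> inverse c * q (sc c v)"
      using that by (intro le) simp
    then show "c * q v \<le> q (sc c v)"
      using that by (simp add: field_simps)
  qed
  then have "q (sc c v) = c * q v" if "0 \<le> c" for c v
    using that zero by (cases "c = 0") auto
  then show ?thesis using add by (simp add: sublinear_def)
qed

lemma sublinear_zero:
  assumes "vector_space sc" "sublinear sc q"
  shows "q 0 = 0"
proof -
  interpret vector_space sc by fact
  show ?thesis using sublinear_scale[OF assms(2), of 0 0] by simp
qed

lemma sublinear_minus:
  assumes "vector_space sc" "sublinear sc q"
  shows "- q (- v) \<le> q v"
  using sublinear_add[OF assms(2), of v "- v"] sublinear_zero[OF assms] by simp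

text \<open>Lowers \<open>q\<close> as far as sublinearity permits while keeping it equal to \<open>- q w\<close> at \<open>- w\<close>.\<close>

lemma sublinear_lower:
  assumes V: "vector_space sc" and q: "sublinear sc q"
  obtains r where "sublinear sc r" "\<And>v. r v \<le> q v" "\<And>v. r v \<le> q (v + w) - q w"
proof -
  interpret vector_space sc by fact
  define r where "r v = (INF t\<in>{0..}. q (v + sc t w) - t * q w)" for v
  \<comment> \<open>A lower bound independent of \<open>t\<close>, needed for the real infimum to be
    meaningful.\<close>
  have bdd: "bdd_below ((\<lambda>t. q (v + sc t w) - t * q w) ` {0..})" for v
  proof (rule bdd_belowI2)
    fix t :: real assume "t \<in> {0..}"
    then have "t * q w = q (sc t w)" by (simp add: sublinear_scale[OF q])
    also have "\<dots> \<le> q (v + sc t w) + q (- v)"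
      using sublinear_add[OF q, of "v + sc t w" "- v"] by simp
    finally show "- q (- v) \<le> q (v + sc t w) - t * q w" by simp
  qed
  have low: "r v \<le> q (v + sc t w) - t * q w" if "0 \<le> t" for v t
    unfolding r_def using that by (intro cINF_lower[OF bdd]) simp
  have great: "a \<le> r v" if "\<And>t. 0 \<le> t \<Longrightarrow> a \<le> q (v + sc t w) - t * q w" for a v
    unfolding r_def using that by (intro cINF_greatest) auto
  have "sublinear sc r"
  proof (rule sublinearI[OF V])
    fix u v
    \<comment> \<open>The two infima are removed one at a time, with parameter \<open>t\<close> for
      \<open>v\<close> and \<open>s\<close> for \<open>u\<close>; the parameter \<open>s + t\<close>
      serves \<open>u + v\<close>.\<close>
    have "r (u + v) - r u \<le> r v"
    proof (rule great)
      fix t :: real assume t: "0 \<le> t"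
      have "r (u + v) - (q (v + sc t w) - t * q w) \<le> r u"
      proof (rule great)
        fix s :: real assume s: "0 \<le> s"
        have "r (u + v) \<le> q (u + v + sc (s + t) w) - (s + t) * q w"
          using s t by (intro low) simp
        also have "q (u + v + sc (s + t) w) \<le> q (u + sc s w) + q (v + sc t w)"
          using sublinear_add[OF q, of "u + sc s w" "v + sc t w"]
          by (simp add: scale_left_distrib algebra_simps)
        finally show "r (u + v) - (q (v + sc t w) - t * q w) \<le> q (u + sc s w) - s * q w"
          by (simp add: algebra_simps)
      qed
      then show "r (u + v) - r u \<le> q (v + sc t w) - t * q w" by simp
    qed
    then show "r (u + v) \<le> r u + r v" by simp
  next
    fix c :: real and v assume c: "0 < c"
    have "inverse c * r (sc c v) \<le> r v"
    proof (rule great)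
      fix t :: real assume t: "0 \<le> t"
      have eq: "q (sc c v + sc (c * t) w) = c * q (v + sc t w)"
        using sublinear_scale[OF q, of c "v + sc t w"] c by (simp add: scale_right_distrib)
      have "r (sc c v) \<le> q (sc c v + sc (c * t) w) - c * t * q w"
        using c t by (intro low) simp
      then show "inverse c * r (sc c v) \<le> q (v + sc t w) - t * q w"
        unfolding eq using c by (simp add: field_simps)
    qed
    then show "r (sc c v) \<le> c * r v" using c by (simp add: field_simps)
  qed
  \<comment> \<open>The parameters \<open>0\<close> and \<open>1\<close> give the two upper bounds
    on \<open>r\<close>.\<close>
  then show ?thesis
    using low[of 0] low[of 1] by (intro that) simp_all
qed

text \<open>Zorn's lemma for the reversed pointwise order: the pointwise infimum of a nonempty chain
  below \<open>q\<close> is finite, being at least \<open>- q (- v)\<close> at \<open>v\<close>, and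
  it is again sublinear.\<close>

lemma sublinear_minimal:
  assumes V: "vector_space sc" and q: "sublinear sc q"
  obtains m where "sublinear sc m" "\<And>v. m v \<le> q v"
    "\<And>r. sublinear sc r \<Longrightarrow> (\<And>v. r v \<le> m v) \<Longrightarrow> r = m"
proof -
  define A where "A = {r. sublinear sc r \<and> (\<forall>v. r v \<le> q v)}"
  have "\<exists>m\<in>A. \<forall>r\<in>A. r \<le> m \<longrightarrow> r = m"
  proof (rule predicate_Zorn)
    show "partial_order_on A (relation_of (\<lambda>a b. b \<le> a) A)"
      by (rule partial_order_on_relation_ofI) auto
  next
    fix C assume "C \<in> Chains (relation_of (\<lambda>a b. b \<le> a) A)"
    then have CA: "C \<subseteq> A" and chain: "\<And>a b. a \<in> C \<Longrightarrow> b \<in> C \<Longrightarrow> a \<le> b \<or> b \<le> a"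
      by (auto simp: Chains_def relation_of_def)
    show "\<exists>u\<in>A. \<forall>a\<in>C. u \<le> a"
    proof (cases "C = {}")
      case True
      then show ?thesis using q by (auto simp: A_def)
    next
      case False
      define u where "u v = (INF a\<in>C. a v)" for v
      have sub: "sublinear sc a" and leq: "a v \<le> q v" if "a \<in> C" for a v
        using CA that by (auto simp: A_def)
      have bdd: "bdd_below ((\<lambda>a. a v) ` C)" for v
      proof (rule bdd_belowI2)
        fix a assume "a \<in> C"
        then show "- q (- v) \<le> a v"
          using sublinear_minus[OF V sub, of a v] leq[of a "- v"] by simp
      qed
      have low: "u v \<le> a v" if "a \<in> C" for a v
        unfolding u_def using that by (intro cINF_lower[OF bdd])
      have great: "b \<le> u v" if "\<And>a. a \<in> C \<Longrightarrow> b \<le> a v" for b v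
        unfolding u_def using that False by (intro cINF_greatest)
      have "sublinear sc u"
      proof (rule sublinearI[OF V])
        fix v w
        have "u (v + w) - u v \<le> u w"
        proof (rule great)
          fix b assume b: "b \<in> C"
          have "u (v + w) - b w \<le> u v"
          proof (rule great)
            fix a assume a: "a \<in> C"
            \<comment> \<open>Subadditivity survives the infimum because two members of a chain have
              a common lower bound in it.\<close>
            obtain c where c: "c \<in> C" "c \<le> a" "c \<le> b"
              using chain[OF a b] a b by auto
            have "u (v + w) \<le> c v + c w"
              using low[OF c(1), of "v + w"] sublinear_add[OF sub[OF c(1)], of v w] by simp
            also have "\<dots> \<le> a v + b w" using c by (intro add_mono) (auto simp: le_fun_def)
            finally show "u (v + w) - b w \<le> a v" by simp
          qed
          then show "u (v + w) - u v \<le> b w" by simp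
        qed
        then show "u (v + w) \<le> u v + u w" by simp
      next
        fix c :: real and v assume c: "0 < c"
        have "inverse c * u (sc c v) \<le> u v"
        proof (rule great)
          fix a assume a: "a \<in> C"
          show "inverse c * u (sc c v) \<le> a v"
            using low[OF a, of "sc c v"] c
            by (simp add: sublinear_scale[OF sub[OF a]] field_simps)
        qed
        then show "u (sc c v) \<le> c * u v" using c by (simp add: field_simps)
      qed
      moreover obtain a where "a \<in> C" using False by auto
      ultimately have "u \<in> A"
        unfolding A_def mem_Collect_eq by (blast intro: order_trans[OF low leq])
      then show ?thesis using low by (auto simp: le_fun_def)
    qed
  qed
  then obtain m where m: "m \<in> A" "\<And>r. r \<in> A \<Longrightarrow> r \<le> m \<Longrightarrow> r = m" by auto
  show ?thesis
  proof (rule that)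
    show "sublinear sc m" "\<And>v. m v \<le> q v" using m(1) by (auto simp: A_def)
    then show "r = m" if "sublinear sc r" "\<And>v. r v \<le> m v" for r
      using that by (intro m(2)) (auto simp: A_def le_fun_def intro: order_trans)
  qed
qed

text \<open>A minimal sublinear functional is linear, since lowering it does not change it.\<close>

theorem Hahn_Banach_point:
  assumes V: "vector_space sc" and p: "sublinear sc p"
  obtains l where "\<And>v w. l (v + w) = l v + l w" "\<And>c v. l (sc c v) = c * l v"
    "\<And>v. l v \<le> p v" "l a = p a"
proof -
  interpret vector_space sc by fact
  \<comment> \<open>Lowering \<open>p\<close> at \<open>a\<close> first forces
    \<open>q (- a) \<le> - p a\<close>, so every linear functional below \<open>q\<close> takes the
    value \<open>p a\<close> at \<open>a\<close>.\<close>
  obtain q where q: "sublinear sc q" "\<And>v. q v \<le> p v" "\<And>v. q v \<le> p (v + a) - p a"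
    using sublinear_lower[OF V p] by blast
  obtain l where l: "sublinear sc l" "\<And>v. l v \<le> q v"
    and min: "\<And>r. sublinear sc r \<Longrightarrow> (\<And>v. r v \<le> l v) \<Longrightarrow> r = l"
    using sublinear_minimal[OF V q(1)] by blast
  have add: "l (v + w) = l v + l w" for v w
  proof -
    \<comment> \<open>By minimality the lowered functional is \<open>l\<close> itself, and its last
      bound then says that \<open>l\<close> is superadditive.\<close>
    obtain r where r: "sublinear sc r" "\<And>v. r v \<le> l v" "\<And>v. r v \<le> l (v + w) - l w"
      using sublinear_lower[OF V l(1)] by blast
    have "r = l" using r(1,2) by (rule min)
    then show ?thesis using r(3)[of v] sublinear_add[OF l(1), of v w] by simp
  qed
  have zero: "l 0 = 0" using sublinear_zero[OF V l(1)] .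
  have minus: "l (- v) = - l v" for v using add[of v "- v"] zero by simp
  show ?thesis
  proof (rule that[OF add])
    show "l (sc c v) = c * l v" for c v
    proof (cases "0 \<le> c")
      case False
      then have "l (sc (- c) v) = - c * l v" by (intro sublinear_scale[OF l(1)]) simp
      then show ?thesis using minus[of "sc c v"] by simp
    qed (rule sublinear_scale[OF l(1)])
    show "l v \<le> p v" for v using l(2) q(2) by (rule order_trans)
    have "l (- a) \<le> - p a"
      using l(2)[of "- a"] q(3)[of "- a"] sublinear_zero[OF V p] by simp
    then show "l a = p a" using l(2)[of a] q(2)[of a] minus[of a] by simp
  qed
qed

text \<open>A real functional below \<open>p\<close> is the real part of a complex one; multiplying
  \<open>v\<close> by a unimodular scalar turns the bound on the real part into one on the
  modulus.\<close>

corollary Hahn_Banach_seminorm: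
  fixes smul :: "complex \<Rightarrow> 'x \<Rightarrow> 'x::ab_group_add"
  assumes "vector_space smul" and p: "seminorm smul p"
  obtains \<phi> where "Vector_Spaces.linear smul (*) \<phi>" "\<And>v. cmod (\<phi> v) \<le> p v" "cmod (\<phi> a) = p a"
proof -
  interpret vector_space smul by fact
  let ?R = "\<lambda>t::real. smul (of_real t)"
  have R: "vector_space ?R"
    by unfold_locales (simp_all add: scale_right_distrib scale_left_distrib)
  have "sublinear ?R p" using p by (auto simp: sublinear_def seminorm_def)
  then obtain l where add: "\<And>v w. l (v + w) = l v + l w"
    and scal: "\<And>c v. l (smul (of_real c) v) = c * l v"
    and le: "\<And>v. l v \<le> p v" and la: "l a = p a"
    using Hahn_Banach_point[OF R] by blast
  define \<phi> where "\<phi> v = Complex (l v) (- l (smul \<i> v))" for v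
  have smul: "l (smul c v) = Re c * l v + Im c * l (smul \<i> v)" for c v
  proof -
    have "smul c v = smul (of_real (Re c)) v + smul (of_real (Im c)) (smul \<i> v)"
      by (subst complex_eq) (simp add: scale_left_distrib mult.commute)
    then show ?thesis using scal[of "Im c" "smul \<i> v"] by (simp add: add scal)
  qed
  have lin: "\<phi> (v + w) = \<phi> v + \<phi> w" "\<phi> (smul c v) = c * \<phi> v" for v w c
    using smul[of c v] smul[of "\<i> * c" v] by (simp_all add: \<phi>_def complex_eq_iff scale_right_distrib add)
  have bound: "cmod (\<phi> v) \<le> p v" for v
  proof (cases "\<phi> v = 0")
    \<comment> \<open>There is no phase to rotate by here. What is needed is
      \<open>0 \<le> p v\<close>, which follows from \<open>l v \<le> p v\<close> and
      \<open>- l v \<le> p v\<close>.\<close>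
    case True
    have "l 0 = 0" using scal[of 0 0] by simp
    have "l (-v) = - l v" using add[of v "-v"] \<open>l 0 = 0\<close> by simp
    have "p (smul (-1) v) = p v" using p by (simp add: seminorm_def del: scale_minus_left)
    then show ?thesis using True le[of v] le[of "-v"] \<open>l (-v) = _\<close> by simp
  next
    case False
    define c where "c = cnj (sgn (\<phi> v))"
    have "c * \<phi> v = of_real (cmod (\<phi> v))"
      using False by (simp add: c_def sgn_div_norm scaleR_conv_of_real field_simps
          complex_norm_square[symmetric] power2_eq_square)
    then have "cmod (\<phi> v) = Re (\<phi> (smul c v))" by (simp add: lin)
    also have "\<dots> = l (smul c v)" by (simp add: \<phi>_def)
    also have "\<dots> \<le> p (smul c v)" by (rule le)
    also have "\<dots> = p v" using p False by (simp add: seminorm_def c_def norm_sgn)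
    finally show ?thesis .
  qed
  show ?thesis
  proof (rule that[OF _ bound])
    show "Vector_Spaces.linear smul (*) \<phi>"
      by unfold_locales (simp_all add: lin algebra_simps)
    show "cmod (\<phi> a) = p a"
      using bound[of a] abs_Re_le_cmod[of "\<phi> a"] la by (simp add: \<phi>_def)
  qed
qed

section \<open>Sectors and quantitative uniqueness on them\<close>

lemma of_real_in_sector: "0 < \<beta> \<Longrightarrow> 0 < t \<Longrightarrow> of_real t \<in> sector \<beta>"
  by (simp add: sector_def)

text \<open>\<open>Arg\<close> is continuous only off the closed negative half-line. Its value there
  is \<open>pi\<close>, so the strict inequality with \<open>\<beta> \<le> pi\<close> keeps the
  sector away from the cut.\<close>

lemma open_sector:
  assumes "\<beta> \<le> pi"
  shows "open (sector \<beta>)"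
proof -
  have "sector \<beta> = {z \<in> - \<real>\<^sub>\<le>\<^sub>0. \<bar>Arg z\<bar> < \<beta>}"
    using assms Arg_eq_pi by (force simp: sector_def complex_nonpos_Reals_iff complex_eq_iff)
  also have "\<dots> = - \<real>\<^sub>\<le>\<^sub>0 \<inter> (\<lambda>z. \<bar>Arg z\<bar>) -` {..<\<beta>}" by auto
  also have "open \<dots>"
    by (intro continuous_open_preimage continuous_intros) auto
  finally show ?thesis .
qed

lemma sector_eq_rcis_image:
  assumes "\<beta> \<le> pi"
  shows "sector \<beta> = (\<lambda>(r, t). rcis r t) ` ({0<..} \<times> {-\<beta><..<\<beta>})"
proof (intro equalityI subsetI)
  fix z assume "z \<in> sector \<beta>"
  then have "z = (\<lambda>(r, t). rcis r t) (cmod z, Arg z)" "(cmod z, Arg z) \<in> {0<..} \<times> {-\<beta><..<\<beta>}"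
    by (auto simp: sector_def rcis_cmod_Arg)
  then show "z \<in> (\<lambda>(r, t). rcis r t) ` ({0<..} \<times> {-\<beta><..<\<beta>})" by (rule image_eqI)
next
  fix z assume "z \<in> (\<lambda>(r, t). rcis r t) ` ({0<..} \<times> {-\<beta><..<\<beta>})"
  then show "z \<in> sector \<beta>"
    using assms by (auto simp: sector_def Arg_rcis)
qed

lemma connected_sector:
  assumes "\<beta> \<le> pi"
  shows "connected (sector \<beta>)"
  unfolding sector_eq_rcis_image[OF assms]
  by (intro connected_continuous_image connected_Times)
     (auto simp: rcis_def case_prod_unfold intro!: continuous_intros)

text \<open>Montel's theorem turns the identity theorem into this quantitative form.\<close>

lemma sector_smallness_propagation:
  assumes "0 < \<beta>" "\<beta> < \<beta>'" "\<beta>' \<le> pi" "0 < \<epsilon>"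
  obtains \<delta> where "0 < \<delta>"
    "\<And>h z. h holomorphic_on sector \<beta>' \<Longrightarrow> (\<And>u. u \<in> sector \<beta>' \<Longrightarrow> cmod (h u) \<le> M) \<Longrightarrow>
       (\<And>t. 1/2 \<le> t \<Longrightarrow> t \<le> 2 \<Longrightarrow> cmod (h (of_real t)) < \<delta>) \<Longrightarrow>
       z \<in> sector \<beta> \<Longrightarrow> cmod z = 1 \<Longrightarrow> cmod (h z) < \<epsilon>"
proof (rule ccontr)
  assume contra: "\<not> thesis"
  define \<H> where "\<H> = {h. h holomorphic_on sector \<beta>' \<and> (\<forall>u\<in>sector \<beta>'. cmod (h u) \<le> M)}"
  \<comment> \<open>If no modulus works, then each \<open>1/(n+1)\<close> fails and yields a
    counterexample.\<close>
  have "\<exists>h z. h \<in> \<H> \<and> (\<forall>t. 1/2 \<le> t \<longrightarrow> t \<le> 2 \<longrightarrow> cmod (h (of_real t)) < inverse (Suc n)) \<and>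
      z \<in> sector \<beta> \<and> cmod z = 1 \<and> \<epsilon> \<le> cmod (h z)" for n
  proof (rule ccontr)
    assume none: "\<not> ?thesis"
    have "thesis"
    proof (rule that)
      show "0 < inverse (real (Suc n))" by simp
      show "cmod (h z) < \<epsilon>"
        if "h holomorphic_on sector \<beta>'" "\<And>u. u \<in> sector \<beta>' \<Longrightarrow> cmod (h u) \<le> M"
          "\<And>t. 1/2 \<le> t \<Longrightarrow> t \<le> 2 \<Longrightarrow> cmod (h (of_real t)) < inverse (real (Suc n))"
          "z \<in> sector \<beta>" "cmod z = 1" for h z
        using none that unfolding \<H>_def mem_Collect_eq by (meson not_le)
    qed
    with contra show False ..
  qed
  then obtain h z where h: "\<And>n. h n \<in> \<H>"
    and small: "\<And>n t. 1/2 \<le> t \<Longrightarrow> t \<le> 2 \<Longrightarrow> cmod (h n (of_real t)) < inverse (Suc n)"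
    and z: "\<And>n. z n \<in> sector \<beta>" "\<And>n. cmod (z n) = 1" and big: "\<And>n. \<epsilon> \<le> cmod (h n (z n))"
    by metis
  have opn: "open (sector \<beta>')" and conn: "connected (sector \<beta>')"
    using assms by (auto intro: open_sector connected_sector)
  obtain g r where g: "g holomorphic_on sector \<beta>'" "strict_mono r"
    and lim: "\<And>u. u \<in> sector \<beta>' \<Longrightarrow> (\<lambda>n. h (r n) u) \<longlonglongrightarrow> g u"
    and unif: "\<And>K. compact K \<Longrightarrow> K \<subseteq> sector \<beta>' \<Longrightarrow> uniform_limit K (h \<circ> r) g sequentially"
  proof (rule Montel[OF opn, of \<H> h])
    show "\<exists>B. \<forall>h\<in>\<H>. \<forall>z\<in>K. cmod (h z) \<le> B" if "compact K" "K \<subseteq> sector \<beta>'" for K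
      using that by (intro exI[of _ M]) (auto simp: \<H>_def)
  qed (use h in \<open>auto simp: \<H>_def\<close>)
  have inS: "of_real t \<in> sector \<beta>'" if "0 < t" for t
    using that assms by (intro of_real_in_sector) auto
  have zero: "g (of_real t) = 0" if "1/2 \<le> t" "t \<le> 2" for t
  proof -
    have "(\<lambda>n. h n (of_real t)) \<longlonglongrightarrow> 0"
      by (rule Lim_null_comparison[OF _ LIMSEQ_inverse_real_of_nat])
         (intro always_eventually allI less_imp_le small that)
    then have "(\<lambda>n. h (r n) (of_real t)) \<longlonglongrightarrow> 0"
      using LIMSEQ_subseq_LIMSEQ[OF _ g(2)] by (fastforce simp: o_def)
    then show ?thesis using lim[OF inS] that by (intro LIMSEQ_unique) auto
  qed
  let ?U = "complex_of_real ` {1/2..2}"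
  \<comment> \<open>The zeros of the limit accumulate at the interior point \<open>1\<close>, so the
    identity theorem applies.\<close>
  have g0: "g u = 0" if "u \<in> sector \<beta>'" for u
  proof (rule analytic_continuation[OF g(1) opn conn, of ?U 1])
    show "?U \<subseteq> sector \<beta>'" "1 \<in> sector \<beta>'" using inS inS[of 1] by auto
    have "(1::real) islimpt {1/2..2}" by (simp add: islimpt_Icc)
    then show "1 islimpt ?U"
      using islimpt_isCont_image[of 1 "{1/2..2}" complex_of_real]
      by (auto simp: eventually_at_filter continuous_intros)
  qed (use zero that in auto)
  \<comment> \<open>The points \<open>z n\<close> vary with \<open>n\<close>, so uniform convergence
    is required. They all lie on this closed arc, which is a compact subset of the larger sector
    because \<open>\<beta> < \<beta>'\<close>.\<close>
  let ?K = "cis ` {-\<beta>..\<beta>}"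
  have K: "compact ?K" by (intro compact_continuous_image continuous_intros) auto
  have "?K \<subseteq> sector \<beta>'" using assms by (auto simp: sector_def Arg_cis)
  from unif[OF K this] have "\<forall>\<^sub>F n in sequentially. \<forall>u\<in>?K. dist ((h \<circ> r) n u) (g u) < \<epsilon>"
    using \<open>0 < \<epsilon>\<close> by (rule uniform_limitD)
  then obtain n where n: "\<And>u. u \<in> ?K \<Longrightarrow> dist (h (r n) u) (g u) < \<epsilon>"
    by (auto simp: eventually_sequentially)
  have "z (r n) = cis (Arg (z (r n)))"
    using rcis_cmod_Arg[of "z (r n)"] z(2)[of "r n"] by (simp add: rcis_def)
  moreover have "Arg (z (r n)) \<in> {-\<beta>..\<beta>}" using z(1)[of "r n"] by (auto simp: sector_def)
  ultimately have zK: "z (r n) \<in> ?K" by (rule image_eqI)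
  then have "z (r n) \<in> sector \<beta>'" using \<open>?K \<subseteq> _\<close> by blast
  then show False using n[OF zK] g0 big[of "r n"] by simp
qed

section \<open>Slices in one coordinate and propagation of smallness in several variables\<close>

definition vec_upd :: "'a ^ 'n \<Rightarrow> 'n \<Rightarrow> 'a \<Rightarrow> 'a ^ 'n" where
  "vec_upd z j u = (\<chi> i. if i = j then u else z $ i)"

lemma vec_upd_nth: "vec_upd z j u $ i = (if i = j then u else z $ i)"
  by (simp add: vec_upd_def)

lemma sectors_mono: "(\<And>j. \<beta> $ j \<le> \<beta>' $ j) \<Longrightarrow> sectors \<beta> \<subseteq> sectors \<beta>'"
  by (force simp: sectors_def sector_def intro: less_le_trans)

lemma cvec_in_sectors: "(\<And>j. 0 < \<beta> $ j) \<Longrightarrow> (\<And>j. 0 < t $ j) \<Longrightarrow> cvec t \<in> sectors \<beta>"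
  by (simp add: sectors_def cvec_def of_real_in_sector)

context sclcs
begin

text \<open>Domination by \<open>p\<close> carries the convergence of the finite partial sums over
  to the scalars, so that a vector-valued power series becomes a scalar one.\<close>

lemma has_sum_continuous_functional:
  assumes lin: "Vector_Spaces.linear smul (*) \<phi>" and p: "continuous_seminorm smul p"
    and le: "\<And>v. cmod (\<phi> v) \<le> p v" and sum: "(g has_sum s) A"
  shows "((\<lambda>k. \<phi> (g k)) has_sum \<phi> s) A"
proof -
  interpret \<phi>: Vector_Spaces.linear smul "(*)" \<phi> by fact
  have "((\<lambda>F. \<phi> (sum g F)) \<longlongrightarrow> \<phi> s) (finite_subsets_at_top A)"
  proof (rule tendstoI)
    fix e :: real assume "0 < e"
    then have "\<forall>\<^sub>F F in finite_subsets_at_top A. p (sum g F - s) < e"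
      using sum p unfolding has_sum_def tendsto_iff_seminorm by blast
    then show "\<forall>\<^sub>F F in finite_subsets_at_top A. dist (\<phi> (sum g F)) (\<phi> s) < e"
      by (rule eventually_mono) (use le in \<open>auto simp: dist_norm \<phi>.diff[symmetric] intro: le_less_trans\<close>)
  qed
  then show ?thesis by (simp add: has_sum_def \<phi>.sum)
qed

text \<open>When only coordinate \<open>j\<close> moves away from the centre, the multi-indices
  supported at \<open>j\<close> alone survive, and the expansion becomes a power series in one
  variable.\<close>

lemma holomorphic_on_slice:
  fixes f :: "complex ^ 'n::finite \<Rightarrow> 'x"
  assumes f: "lc_holomorphic_on smul f D"
    and lin: "Vector_Spaces.linear smul (*) \<phi>" and p: "continuous_seminorm smul p"
    and le: "\<And>v. cmod (\<phi> v) \<le> p v"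
    and S: "\<And>u. u \<in> S \<Longrightarrow> vec_upd z j u \<in> D"
  shows "(\<lambda>u. \<phi> (f (vec_upd z j u))) holomorphic_on S"
proof -
  interpret \<phi>: Vector_Spaces.linear smul "(*)" \<phi> by fact
  have "(\<lambda>u. \<phi> (f (vec_upd z j u))) field_differentiable at a" if a: "a \<in> S" for a
  proof -
    define b where "b = vec_upd z j a"
    obtain r :: "real ^ 'n" and c :: "nat ^ 'n \<Rightarrow> 'x" where r: "\<And>i. 0 < r $ i"
      and sum: "\<And>w. w \<in> polydisc b r \<Longrightarrow>
        ((\<lambda>k. smul (\<Prod>i\<in>UNIV. (w $ i - b $ i) ^ (k $ i)) (c k)) has_sum f w) UNIV"
      using bspec[OF f[unfolded lc_holomorphic_on_def] S[OF a]]
      unfolding b_def by (elim exE conjE) blast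
    define E :: "nat \<Rightarrow> nat ^ 'n" where "E m = vec_upd 0 j m" for m
    have E: "E m $ i = (if i = j then m else 0)" for m i by (simp add: E_def vec_upd_nth)
    have "inj E" by (metis E injI)
    have "(\<lambda>m. \<phi> (c (E m)) * (u - a) ^ m) sums \<phi> (f (vec_upd z j u))" if "u \<in> ball a (r $ j)" for u
    proof -
      let ?w = "vec_upd z j u"
      let ?t = "\<lambda>k. \<phi> (smul (\<Prod>i\<in>UNIV. (?w $ i - b $ i) ^ (k $ i)) (c k))"
      have "?w \<in> polydisc b r"
        using that r by (auto simp: polydisc_def b_def vec_upd_nth dist_norm norm_minus_commute)
      then have full: "(?t has_sum \<phi> (f ?w)) UNIV"
        by (intro has_sum_continuous_functional[OF lin p le] sum)
      \<comment> \<open>Any other multi-index contributes a factor \<open>0\<close> to a positive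
        power.\<close>
      have vanish: "?t k = 0" if "k \<notin> range E" for k
      proof -
        have "\<exists>i. i \<noteq> j \<and> k $ i \<noteq> 0"
        proof (rule ccontr)
          assume "\<not> ?thesis"
          then have "k = E (k $ j)" by (auto simp: vec_eq_iff E)
          with that show False by blast
        qed
        then obtain i where "i \<noteq> j" "k $ i \<noteq> 0" by blast
        then have "(?w $ i - b $ i) ^ (k $ i) = 0" by (simp add: b_def vec_upd_nth)
        then have "(\<Prod>i\<in>UNIV. (?w $ i - b $ i) ^ (k $ i)) = 0" by (intro prod_zero) auto
        then show ?thesis by (simp only: scale_zero_left \<phi>.zero)
      qed
      have "(?t has_sum \<phi> (f ?w)) (range E) \<longleftrightarrow> (?t has_sum \<phi> (f ?w)) UNIV"
        by (rule has_sum_cong_neutral) (use vanish in blast)+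
      with full have "(?t has_sum \<phi> (f ?w)) (range E)" by (rule iffD2[rotated])
      then have "((?t \<circ> E) has_sum \<phi> (f ?w)) UNIV"
        using \<open>inj E\<close> by (simp only: has_sum_reindex)
      \<comment> \<open>The factors with \<open>i \<noteq> j\<close> are
        \<open>0 ^ 0 = 1\<close>.\<close>
      moreover have "(\<Prod>i\<in>UNIV. (?w $ i - b $ i) ^ (E m $ i)) = (u - a) ^ m" for m
      proof -
        have "(\<Prod>i\<in>UNIV. (?w $ i - b $ i) ^ (E m $ i)) = (\<Prod>i\<in>UNIV. if i = j then (u - a) ^ m else 1)"
          by (intro prod.cong) (auto simp: E b_def vec_upd_nth)
        then show ?thesis by simp
      qed
      ultimately have "((\<lambda>m. \<phi> (c (E m)) * (u - a) ^ m) has_sum \<phi> (f ?w)) UNIV"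
        by (simp add: o_def \<phi>.scale mult.commute)
      then show ?thesis by (rule has_sum_imp_sums)
    qed
    then have "(\<lambda>u. \<phi> (f (vec_upd z j u))) holomorphic_on ball a (r $ j)"
      by (rule power_series_holomorphic)
    then show ?thesis
      using r by (intro holomorphic_on_imp_differentiable_at[of _ "ball a (r $ j)"]) auto
  qed
  then show ?thesis
    by (simp add: holomorphic_on_def field_differentiable_at_within)
qed

text \<open>Sectors are invariant under positive scaling, so dividing coordinate \<open>j\<close> by
  its modulus reduces to the unit circle in one variable.\<close>

lemma smallness_propagation_coordinate:
  fixes f :: "complex ^ 'n::finite \<Rightarrow> 'x"
  assumes f: "lc_holomorphic_on smul f (sectors \<alpha>)" and p: "continuous_seminorm smul p"
    and \<beta>: "\<And>j. 0 < \<beta> $ j" "\<And>j. \<beta> $ j < \<beta>' $ j" "\<And>j. \<beta>' $ j < \<alpha> $ j" "\<And>j. \<alpha> $ j \<le> pi"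
    and bdd: "lc_bounded smul (f ` sectors \<beta>')" and "0 < \<epsilon>"
  obtains \<delta> where "0 < \<delta>"
    "\<And>z. z \<in> sectors \<beta> \<Longrightarrow>
       (\<And>t. 1/2 \<le> t \<Longrightarrow> t \<le> 2 \<Longrightarrow> p (f (vec_upd z j (of_real (t * cmod (z $ j)))) - x) < \<delta>) \<Longrightarrow>
       p (f z - x) < \<epsilon>"
proof -
  have semi: "seminorm smul p" using p by (simp add: continuous_seminorm_def)
  obtain M where M: "\<And>w. w \<in> sectors \<beta>' \<Longrightarrow> p (f w) \<le> M"
    using bdd p unfolding lc_bounded_def bdd_above_def by (meson imageI)
  have "\<beta>' $ j \<le> pi" using \<beta>(3,4) by (meson less_imp_le order_trans)
  \<comment> \<open>The bound \<open>M + p (- x)\<close> covers \<open>f - x\<close> on all of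
    \<open>sectors \<beta>'\<close>. Hence \<open>\<delta>\<close> is fixed before \<open>z\<close>,
    although the functional chosen below depends on \<open>z\<close>.\<close>
  then obtain \<delta> where \<delta>: "0 < \<delta>"
    "\<And>h z. h holomorphic_on sector (\<beta>' $ j) \<Longrightarrow>
       (\<And>u. u \<in> sector (\<beta>' $ j) \<Longrightarrow> cmod (h u) \<le> M + p (- x)) \<Longrightarrow>
       (\<And>t. 1/2 \<le> t \<Longrightarrow> t \<le> 2 \<Longrightarrow> cmod (h (of_real t)) < \<delta>) \<Longrightarrow>
       z \<in> sector (\<beta> $ j) \<Longrightarrow> cmod z = 1 \<Longrightarrow> cmod (h z) < \<epsilon>"
    using sector_smallness_propagation[OF \<beta>(1,2) _ \<open>0 < \<epsilon>\<close>, of j "M + p (- x)"] by blast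
  show ?thesis
  proof (rule that[OF \<delta>(1)])
    fix z assume z: "z \<in> sectors \<beta>"
      and small: "\<And>t. 1/2 \<le> t \<Longrightarrow> t \<le> 2 \<Longrightarrow>
        p (f (vec_upd z j (of_real (t * cmod (z $ j)))) - x) < \<delta>"
    obtain \<phi> where lin: "Vector_Spaces.linear smul (*) \<phi>" and le: "\<And>v. cmod (\<phi> v) \<le> p v"
      and eq: "cmod (\<phi> (f z - x)) = p (f z - x)"
      using Hahn_Banach_seminorm[OF vector_space_axioms semi] by blast
    interpret \<phi>: Vector_Spaces.linear smul "(*)" \<phi> by fact
    define s where "s = cmod (z $ j)"
    have s: "0 < s" using z by (auto simp: s_def sectors_def sector_def)
    have upd: "vec_upd z j (u * of_real s) \<in> sectors \<beta>'" if "u \<in> sector (\<beta>' $ j)" for u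
    proof -
      have "z \<in> sectors \<beta>'" using sectors_mono[of \<beta> \<beta>'] z \<beta>(2) by (auto intro: less_imp_le)
      then show ?thesis
        using that s by (auto simp: sectors_def vec_upd_nth sector_def)
    qed
    have "sectors \<beta>' \<subseteq> sectors \<alpha>" using \<beta>(3) by (intro sectors_mono less_imp_le)
    define h where "h u = \<phi> (f (vec_upd z j (u * of_real s)) - x)" for u
    let ?S = "(\<lambda>u. u * of_real s) ` sector (\<beta>' $ j)"
    have "(\<lambda>u. \<phi> (f (vec_upd z j u))) holomorphic_on ?S"
      using upd \<open>sectors \<beta>' \<subseteq> _\<close> by (intro holomorphic_on_slice[OF f lin p le]) auto
    then have "(\<lambda>u. \<phi> (f (vec_upd z j u))) \<circ> (\<lambda>u. u * of_real s) holomorphic_on sector (\<beta>' $ j)"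
      by (intro holomorphic_on_compose holomorphic_intros)
    then have hol: "h holomorphic_on sector (\<beta>' $ j)"
      unfolding h_def o_def \<phi>.diff by (intro holomorphic_intros)
    have "cmod (h (z $ j / of_real s)) < \<epsilon>"
    proof (rule \<delta>(2)[OF hol])
      fix u assume "u \<in> sector (\<beta>' $ j)"
      let ?w = "vec_upd z j (u * of_real s)"
      have "cmod (h u) \<le> p (f ?w - x)" unfolding h_def by (rule le)
      also have "\<dots> \<le> p (f ?w) + p (- x)"
        using semi unfolding seminorm_def by (metis diff_conv_add_uminus)
      also have "p (f ?w) \<le> M" using upd[OF \<open>u \<in> _\<close>] by (rule M)
      finally show "cmod (h u) \<le> M + p (- x)" by simp
    next
      fix t :: real assume "1/2 \<le> t" "t \<le> 2"
      have "cmod (h (of_real t)) \<le> p (f (vec_upd z j (of_real t * of_real s)) - x)"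
        unfolding h_def by (rule le)
      also have "\<dots> < \<delta>" using small[OF \<open>1/2 \<le> t\<close> \<open>t \<le> 2\<close>] by (simp add: s_def)
      finally show "cmod (h (of_real t)) < \<delta>" .
    next
      show "cmod (z $ j / of_real s) = 1" using s by (simp add: norm_divide s_def[symmetric])
      show "z $ j / of_real s \<in> sector (\<beta> $ j)"
        using z s by (auto simp: sectors_def sector_def)
    qed
    moreover have "vec_upd z j (z $ j / of_real s * of_real s) = z"
      using s by (simp add: vec_eq_iff vec_upd_nth)
    ultimately show "p (f z - x) < \<epsilon>" by (simp add: h_def eq)
  qed
qed

text \<open>The coordinates in \<open>J\<close> are moved from the half-line into the sector one after the other, each
  move costing a factor \<open>2\<close> in the range of moduli.\<close>

lemma smallness_propagation:
  fixes f :: "complex ^ 'n::finite \<Rightarrow> 'x"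
  assumes f: "lc_holomorphic_on smul f (sectors \<alpha>)" and p: "continuous_seminorm smul p"
    and \<beta>: "\<And>j. 0 < \<beta> $ j" "\<And>j. \<beta> $ j < \<beta>' $ j" "\<And>j. \<beta>' $ j < \<alpha> $ j" "\<And>j. \<alpha> $ j \<le> pi"
    and bdd: "lc_bounded smul (f ` sectors \<beta>')" and "0 < \<epsilon>"
  shows "\<exists>\<delta>>0. \<forall>z\<in>sectors \<beta>.
    (\<forall>j. j \<notin> J \<longrightarrow> z $ j = of_real (cmod (z $ j))) \<longrightarrow>
    (\<forall>t. (\<forall>j. cmod (z $ j) / 2 ^ card J \<le> t $ j \<and> t $ j \<le> 2 ^ card J * cmod (z $ j)) \<longrightarrow>
       p (f (cvec t) - x) < \<delta>) \<longrightarrow>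
    p (f z - x) < \<epsilon>"
  using finite[of J] \<open>0 < \<epsilon>\<close>
proof (induction J arbitrary: \<epsilon> rule: finite_induct)
  case empty
  show ?case
  proof (intro exI[of _ \<epsilon>] conjI ballI impI)
    fix z :: "complex ^ 'n"
    assume real: "\<forall>j. j \<notin> {} \<longrightarrow> z $ j = of_real (cmod (z $ j))"
      and small: "\<forall>t. (\<forall>j. cmod (z $ j) / 2 ^ card {} \<le> t $ j \<and>
        t $ j \<le> 2 ^ card {} * cmod (z $ j)) \<longrightarrow> p (f (cvec t) - x) < \<epsilon>"
    \<comment> \<open>With no coordinate to turn, the point is itself positive and the factor is
      \<open>2 ^ 0 = 1\<close>.\<close>
    have "cvec (\<chi> j. cmod (z $ j)) = z" using real by (simp add: cvec_def vec_eq_iff)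
    then show "p (f z - x) < \<epsilon>" using small[rule_format, of "\<chi> j. cmod (z $ j)"] by simp
  qed (rule empty)
next
  case (insert j J)
  \<comment> \<open>Coordinate \<open>j\<close> is handled first: it is replaced by \<open>s\<close>
    times its modulus with \<open>1/2 \<le> s \<le> 2\<close>, and the induction hypothesis, with
    accuracy \<open>\<eta>\<close>, treats the resulting points.\<close>
  obtain \<eta> where \<eta>: "0 < \<eta>"
    "\<And>z. z \<in> sectors \<beta> \<Longrightarrow>
       (\<And>t. 1/2 \<le> t \<Longrightarrow> t \<le> 2 \<Longrightarrow> p (f (vec_upd z j (of_real (t * cmod (z $ j)))) - x) < \<eta>) \<Longrightarrow>
       p (f z - x) < \<epsilon>"
    using smallness_propagation_coordinate[OF f p \<beta> bdd \<open>0 < \<epsilon>\<close>] by blast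
  obtain \<delta> where \<delta>: "0 < \<delta>"
    "\<And>z. z \<in> sectors \<beta> \<Longrightarrow> (\<And>i. i \<notin> J \<Longrightarrow> z $ i = of_real (cmod (z $ i))) \<Longrightarrow>
      (\<And>t. (\<And>i. cmod (z $ i) / 2 ^ card J \<le> t $ i \<and> t $ i \<le> 2 ^ card J * cmod (z $ i)) \<Longrightarrow>
       p (f (cvec t) - x) < \<delta>) \<Longrightarrow> p (f z - x) < \<eta>"
    using insert.IH[OF \<eta>(1)] by blast
  show ?case
  proof (intro exI[of _ \<delta>] conjI ballI impI)
    fix z assume z: "z \<in> sectors \<beta>"
      and real: "\<forall>i. i \<notin> insert j J \<longrightarrow> z $ i = of_real (cmod (z $ i))"
      and small: "\<forall>t. (\<forall>i. cmod (z $ i) / 2 ^ card (insert j J) \<le> t $ i \<and>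
        t $ i \<le> 2 ^ card (insert j J) * cmod (z $ i)) \<longrightarrow> p (f (cvec t) - x) < \<delta>"
    show "p (f z - x) < \<epsilon>"
    proof (rule \<eta>(2)[OF z])
      fix s :: real assume s: "1/2 \<le> s" "s \<le> 2"
      let ?w = "vec_upd z j (of_real (s * cmod (z $ j)))"
      have pos: "0 < cmod (z $ j)" using z by (auto simp: sectors_def sector_def)
      have w: "cmod (?w $ i) = (if i = j then s * cmod (z $ j) else cmod (z $ i))" for i
        using s by (simp add: vec_upd_nth norm_mult)
      show "p (f ?w - x) < \<eta>"
      proof (rule \<delta>(2))
        have "of_real (s * cmod (z $ j)) \<in> sector (\<beta> $ j)"
          using s pos by (intro of_real_in_sector \<beta>(1) mult_pos_pos) auto
        then show "?w \<in> sectors \<beta>" using z by (auto simp: sectors_def vec_upd_nth)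
        show "?w $ i = of_real (cmod (?w $ i))" if "i \<notin> J" for i
          using real that unfolding w by (auto simp: vec_upd_nth)
        fix t :: "real ^ 'n"
        assume t: "\<And>i. cmod (?w $ i) / 2 ^ card J \<le> t $ i \<and> t $ i \<le> 2 ^ card J * cmod (?w $ i)"
        \<comment> \<open>The moduli of \<open>?w\<close> and \<open>z\<close> differ by a factor at
          most \<open>2\<close>, which accounts for the increase of \<open>card J\<close> by
          one.\<close>
        have "cmod (z $ i) / 2 \<le> cmod (?w $ i)" "cmod (?w $ i) \<le> 2 * cmod (z $ i)" for i
          using s mult_right_mono[of "1/2" s "cmod (z $ j)"] unfolding w by (auto intro: mult_right_mono)
        then have "cmod (z $ i) / 2 / 2 ^ card J \<le> t $ i" "t $ i \<le> 2 ^ card J * (2 * cmod (z $ i))" for i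
          using t[of i] by (meson divide_right_mono mult_left_mono order_trans zero_le_numeral zero_le_power)+
        then show "p (f (cvec t) - x) < \<delta>"
          using insert.hyps by (intro small[rule_format]) (simp add: mult.assoc mult.left_commute)
      qed
    qed
  qed (rule \<delta>(1))
qed

end

section \<open>Comparison of the limits along the half-lines and in the sectors\<close>

lemma filterlim_cvec_each_at_top:
  assumes "\<And>j. 0 < \<beta> $ j"
  shows "filterlim cvec (each_at_infinity_within (sectors \<beta>)) each_at_top"
  unfolding filterlim_iff eventually_each_at_infinity_within eventually_each_at_top
proof (intro allI impI, elim exE conjE)
  fix P M assume "(0::real) < M" and P: "\<forall>z\<in>sectors \<beta>. (\<forall>j. M < cmod (z $ j)) \<longrightarrow> P z"
  have "P (cvec t)" if t: "\<forall>j. M < t $ j" for t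
  proof -
    have pos: "0 < t $ j" for j using \<open>0 < M\<close> t by (meson less_trans)
    then have "cvec t \<in> sectors \<beta>" by (intro cvec_in_sectors assms)
    moreover have "M < cmod (cvec t $ j)" for j using t pos[of j] by (simp add: cvec_def)
    ultimately show ?thesis using P by blast
  qed
  then show "\<exists>M>0. \<forall>t. (\<forall>j. M < t $ j) \<longrightarrow> P (cvec t)" using \<open>0 < M\<close> by blast
qed

lemma norm_cvec: "norm (cvec t) = norm t"
  by (simp add: norm_vec_def cvec_def)

lemma filterlim_cvec_at_0:
  fixes \<beta> :: "real ^ 'n"
  assumes "\<And>j. 0 < \<beta> $ j"
  shows "filterlim cvec (at 0 within sectors \<beta>) (at 0 within {t. \<forall>j. 0 < t $ j})"
proof (rule filterlim_at_withinI)
  have "((\<lambda>t :: real ^ 'n. norm (cvec t)) \<longlongrightarrow> 0) (at 0 within {t. \<forall>j. 0 < t $ j})"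
    unfolding norm_cvec by (intro tendsto_norm_zero tendsto_ident_at)
  then show "filterlim cvec (nhds (0 :: complex ^ 'n)) (at 0 within {t. \<forall>j. 0 < t $ j})"
    by (rule tendsto_norm_zero_cancel)
  have "cvec t \<in> sectors \<beta> - {0}" if "\<forall>j. 0 < t $ j" for t
  proof -
    have "cvec t \<in> sectors \<beta>" using that assms by (intro cvec_in_sectors) auto
    then show ?thesis by (auto simp: sectors_def sector_def)
  qed
  then show "\<forall>\<^sub>F t in at 0 within {t. \<forall>j. 0 < t $ j}. cvec t \<in> sectors \<beta> - {0}"
    by (simp add: eventually_at_filter)
qed

theorem proposition2p20:
  fixes smul :: "complex \<Rightarrow> 'x \<Rightarrow> 'x::{ab_group_add,t2_space}"
    and f :: "complex ^ 'n::finite \<Rightarrow> 'x"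
    and x :: 'x
    and \<alpha> :: "real ^ 'n"
  assumes "sclcs smul"
    and "CARD('n) \<ge> 2"
    and "\<forall>j. 0 < \<alpha> $ j \<and> \<alpha> $ j \<le> pi"
    and "lc_holomorphic_on smul f (sectors \<alpha>)"
    and "\<forall>\<beta>. (\<forall>j. 0 < \<beta> $ j \<and> \<beta> $ j < \<alpha> $ j) \<longrightarrow> lc_bounded smul (f ` sectors \<beta>)"
  shows
    "(\<forall>\<beta>. (\<forall>j. 0 < \<beta> $ j \<and> \<beta> $ j < \<alpha> $ j) \<longrightarrow>
        (((\<lambda>t. f (cvec t)) \<longlongrightarrow> x) each_at_top \<longleftrightarrow>
         (f \<longlongrightarrow> x) (each_at_infinity_within (sectors \<beta>)))) \<and>
     (\<forall>\<beta>. (\<forall>j. 0 < \<beta> $ j \<and> \<beta> $ j < \<alpha> $ j) \<longrightarrow>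
        (((\<lambda>t. f (cvec t)) \<longlongrightarrow> x) (at 0 within {t. \<forall>j. 0 < t $ j}) \<longleftrightarrow>
         (f \<longlongrightarrow> x) (at 0 within sectors \<beta>)))"
proof -
  interpret sclcs smul by fact
  \<comment> \<open>One factor \<open>2\<close> for each coordinate, all of which have to be
    turned.\<close>
  let ?K = "2 ^ CARD('n) :: real"
  have K: "0 < ?K" by simp
  have propagate: "\<exists>\<delta>>0. \<forall>z\<in>sectors \<beta>.
      (\<forall>t. (\<forall>j. cmod (z $ j) / ?K \<le> t $ j \<and> t $ j \<le> ?K * cmod (z $ j)) \<longrightarrow>
        p (f (cvec t) - x) < \<delta>) \<longrightarrow> p (f z - x) < \<epsilon>"
    if \<beta>: "\<forall>j. 0 < \<beta> $ j \<and> \<beta> $ j < \<alpha> $ j" and p: "continuous_seminorm smul p" and "0 < \<epsilon>"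
    for \<beta> p \<epsilon>
  proof -
    \<comment> \<open>An intermediate opening leaves room on both sides: \<open>f\<close> is bounded
      on \<open>sectors \<beta>'\<close>, and smallness can spread over the narrower
      \<open>sectors \<beta>\<close>.\<close>
    define \<beta>' where "\<beta>' = (\<chi> j. (\<beta> $ j + \<alpha> $ j) / 2)"
    have \<beta>': "\<beta> $ j < \<beta>' $ j" "\<beta>' $ j < \<alpha> $ j" for j
      using \<beta> by (auto simp: \<beta>'_def field_simps)
    have "0 < \<beta>' $ j" for j using \<beta> \<beta>'(1) by (meson less_trans)
    then have "lc_bounded smul (f ` sectors \<beta>')" using assms(5) \<beta>'(2) by blast
    \<comment> \<open>For \<open>J = UNIV\<close> the condition that the remaining coordinates be
      positive is vacuous.\<close>
    from smallness_propagation[OF assms(4) p _ \<beta>' _ this \<open>0 < \<epsilon>\<close>, where J = UNIV] \<beta> assms(3)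
    show ?thesis by simp
  qed
  show ?thesis
  proof (intro conjI allI impI iffI)
    fix \<beta> :: "real ^ 'n" assume \<beta>: "\<forall>j. 0 < \<beta> $ j \<and> \<beta> $ j < \<alpha> $ j"
    \<comment> \<open>From the sectors to the half-lines both limits are mere restrictions along
      \<open>cvec\<close>.\<close>
    show "((\<lambda>t. f (cvec t)) \<longlongrightarrow> x) each_at_top"
      if "(f \<longlongrightarrow> x) (each_at_infinity_within (sectors \<beta>))"
      using filterlim_compose[OF that filterlim_cvec_each_at_top] \<beta> by blast
    show "((\<lambda>t. f (cvec t)) \<longlongrightarrow> x) (at 0 within {t. \<forall>j. 0 < t $ j})"
      if "(f \<longlongrightarrow> x) (at 0 within sectors \<beta>)"
      using filterlim_compose[OF that filterlim_cvec_at_0] \<beta> by blast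
    show "(f \<longlongrightarrow> x) (each_at_infinity_within (sectors \<beta>))"
      if lim: "((\<lambda>t. f (cvec t)) \<longlongrightarrow> x) each_at_top"
      unfolding tendsto_iff_seminorm
    proof (intro allI impI)
      fix p and \<epsilon> :: real assume p: "continuous_seminorm smul p" and "0 < \<epsilon>"
      obtain \<delta> where \<delta>: "0 < \<delta>" "\<And>z. z \<in> sectors \<beta> \<Longrightarrow>
        (\<And>t. (\<And>j. cmod (z $ j) / ?K \<le> t $ j \<and> t $ j \<le> ?K * cmod (z $ j)) \<Longrightarrow>
          p (f (cvec t) - x) < \<delta>) \<Longrightarrow> p (f z - x) < \<epsilon>"
        using propagate[OF \<beta> p \<open>0 < \<epsilon>\<close>] by blast
      obtain M where M: "0 < M" "\<And>t. (\<And>j. M < t $ j) \<Longrightarrow> p (f (cvec t) - x) < \<delta>"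
        using lim p \<delta>(1) unfolding tendsto_iff_seminorm eventually_each_at_top by blast
      \<comment> \<open>The threshold is enlarged by \<open>?K\<close> so that every comparison
        point still has all coordinates above \<open>M\<close>.\<close>
      have "p (f z - x) < \<epsilon>" if z: "z \<in> sectors \<beta>" "\<forall>j. ?K * M < cmod (z $ j)" for z
      proof (rule \<delta>(2)[OF z(1)], rule M(2))
        fix t :: "real ^ 'n" and j
        assume "\<And>j. cmod (z $ j) / ?K \<le> t $ j \<and> t $ j \<le> ?K * cmod (z $ j)"
        moreover have "M < cmod (z $ j) / ?K"
          using z(2) K by (simp add: pos_less_divide_eq mult.commute)
        ultimately show "M < t $ j" by (meson less_le_trans)
      qed
      then show "\<forall>\<^sub>F z in each_at_infinity_within (sectors \<beta>). p (f z - x) < \<epsilon>"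
        unfolding eventually_each_at_infinity_within
        using M(1) K by (intro exI[of _ "?K * M"]) auto
    qed
    show "(f \<longlongrightarrow> x) (at 0 within sectors \<beta>)"
      if lim: "((\<lambda>t. f (cvec t)) \<longlongrightarrow> x) (at 0 within {t. \<forall>j. 0 < t $ j})"
      unfolding tendsto_iff_seminorm
    proof (intro allI impI)
      fix p and \<epsilon> :: real assume p: "continuous_seminorm smul p" and "0 < \<epsilon>"
      obtain \<delta> where \<delta>: "0 < \<delta>" "\<And>z. z \<in> sectors \<beta> \<Longrightarrow>
        (\<And>t. (\<And>j. cmod (z $ j) / ?K \<le> t $ j \<and> t $ j \<le> ?K * cmod (z $ j)) \<Longrightarrow>
          p (f (cvec t) - x) < \<delta>) \<Longrightarrow> p (f z - x) < \<epsilon>"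
        using propagate[OF \<beta> p \<open>0 < \<epsilon>\<close>] by blast
      have "\<forall>\<^sub>F t in at 0 within {t. \<forall>j. 0 < t $ j}. p (f (cvec t) - x) < \<delta>"
        using lim p \<delta>(1) unfolding tendsto_iff_seminorm by blast
      then obtain d where d: "0 < d"
        "\<And>t. (\<And>j. 0 < t $ j) \<Longrightarrow> t \<noteq> 0 \<Longrightarrow> norm t < d \<Longrightarrow> p (f (cvec t) - x) < \<delta>"
        unfolding eventually_at by auto
      \<comment> \<open>The upper bounds on \<open>t\<close> give
        \<open>norm t \<le> ?K * norm z\<close>, hence the radius \<open>d / ?K\<close>; the lower
        bounds keep \<open>t\<close> positive.\<close>
      have "p (f z - x) < \<epsilon>" if z: "z \<in> sectors \<beta>" "norm z < d / ?K" for z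
      proof (rule \<delta>(2)[OF z(1)])
        fix t :: "real ^ 'n"
        assume t: "\<And>j. cmod (z $ j) / ?K \<le> t $ j \<and> t $ j \<le> ?K * cmod (z $ j)"
        have pos: "0 < t $ j" for j
        proof -
          have "0 < cmod (z $ j) / ?K"
            using z(1) by (auto simp: sectors_def sector_def)
          then show ?thesis using t by (meson less_le_trans)
        qed
        have "norm (cvec t) \<le> norm (?K *\<^sub>R z)"
          using t pos by (intro norm_le_componentwise_cart) (simp add: cvec_def less_imp_le)
        also have "\<dots> < d" using z(2) K by (simp add: pos_less_divide_eq mult.commute)
        finally show "p (f (cvec t) - x) < \<delta>"
          using pos by (intro d(2)) (auto simp: norm_cvec dest: spec)
      qed
      then show "\<forall>\<^sub>F z in at 0 within sectors \<beta>. p (f z - x) < \<epsilon>"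
        unfolding eventually_at using d(1) K by (intro exI[of _ "d / ?K"]) auto
    qed
  qed
qed

end
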